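(* Let $\{\Gamma_k\}_{k=1}^n$ be a family of $\mathcal{H}$-realizable lists. Then $\Gamma=\bigcup_{k=1}^n\Gamma_k$ is also $\mathcal{H}$-realizable.
   Context: Lists are finite lists of complex numbers with repetitions allowed; unions of lists are taken with multiplicity. Let $J=\begin{pmatrix}0&I_m\\-I_m&0\end{pmatrix}$. A real $2m\times 2m$ matrix $A$ is Hamiltonian if $A^TJ+JA=0$. A list of $2m$ complex numbers is $\mathcal{H}$-realizable if it is the spectrum (eigenvalues with algebraic multiplicity) of some $2m\times 2m$ real Hamiltonian matrix. The lists $\Gamma_k$ may have different lengths. *)

theory Defs
  imports
    Jordan_Normal_Form.Char_Poly
    "HOL-Computational_Algebra.Polynomial"
    "HOL-Library.Multiset"
    Complex_Main
begin

definition symplectic_J :: "nat \<Rightarrow> real mat" where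
  "symplectic_J m = four_block_mat (0\<^sub>m m m) (1\<^sub>m m) (- 1\<^sub>m m) (0\<^sub>m m m)"

definition hamiltonian_mat :: "nat \<Rightarrow> real mat \<Rightarrow> bool" where
  "hamiltonian_mat m A \<longleftrightarrow>
     A \<in> carrier_mat (2 * m) (2 * m) \<and>
     A\<^sup>T * symplectic_J m + symplectic_J m * A = 0\<^sub>m (2 * m) (2 * m)"

(* The eigenvalues of a real square matrix, taken in the complex numbers: the multiplicity of z
   is its order as a root of the (monic, hence nonzero) characteristic polynomial, i.e. its
   algebraic multiplicity. *)
definition spectrum_mset :: "real mat \<Rightarrow> complex multiset" where
  "spectrum_mset A = proots (char_poly (map_mat complex_of_real A))"

(* Unordered lists with repetitions are multisets. Equality with the spectrum of a
   2m x 2m matrix already forces size \<Gamma> = 2 * m. *)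
definition H_realizable :: "complex multiset \<Rightarrow> bool" where
  "H_realizable \<Gamma> \<longleftrightarrow> (\<exists>m\<ge>1. \<exists>A. hamiltonian_mat m A \<and> spectrum_mset A = \<Gamma>)"

end

theory Submission
  imports Defs
begin

text \<open>
  Writing \<open>J m\<close> for the standard symplectic form, the direct sum of Hamiltonian matrices of sizes
  \<open>2p\<close> and \<open>2q\<close> satisfies the Hamiltonian equation for the form \<open>J p \<oplus> J q\<close>. A permutation of the
  basis (half of the second summand is moved past half of the first) carries this form to
  \<open>J (p + q)\<close>; conjugating by the permutation matrix, which is orthogonal, gives a Hamiltonian
  matrix with the same characteristic polynomial, namely the product of the two given ones.
\<close>

text \<open>The characteristic matrix of a block diagonal matrix is again block diagonal, and a
  determinant with a zero lower left block is the product of the determinants of its diagonal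
  blocks.\<close>

lemma char_poly_diag_block:
  fixes A B :: "'a :: idom mat"
  assumes A: "A \<in> carrier_mat n n" and B: "B \<in> carrier_mat k k"
  shows "char_poly (four_block_mat A (0\<^sub>m n k) (0\<^sub>m k n) B) = char_poly A * char_poly B"
proof -
  have eq: "char_poly_matrix (four_block_mat A (0\<^sub>m n k) (0\<^sub>m k n) B) =
    four_block_mat (char_poly_matrix A) (0\<^sub>m n k) (0\<^sub>m k n) (char_poly_matrix B)"
    by (rule eq_matI, insert A B, auto simp: char_poly_matrix_def)
  show ?thesis
    unfolding char_poly_def eq
    by (rule det_four_block_mat_lower_left_zero[where n = n and m = k])
      (use A B in auto)
qed

text \<open>Row \<open>i\<close> is the unit vector at \<open>\<sigma> i\<close>, so multiplying
  from the left selects row \<open>\<sigma> i\<close>. With this convention conjugation reindexes by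
  \<open>\<sigma>\<close> itself rather than by its inverse.\<close>

definition perm_mat :: "nat \<Rightarrow> (nat \<Rightarrow> nat) \<Rightarrow> 'a :: semiring_1 mat" where
  "perm_mat n \<sigma> = mat n n (\<lambda>(i, j). if j = \<sigma> i then 1 else 0)"

lemma perm_mat_carrier [simp, intro]: "perm_mat n \<sigma> \<in> carrier_mat n n"
  by (simp add: perm_mat_def)

lemma perm_mat_conjugate_index:
  assumes A: "A \<in> carrier_mat n n" and "\<sigma> ` {..<n} \<subseteq> {..<n}" and ij: "i < n" "j < n"
  shows "(perm_mat n \<sigma> * A * (perm_mat n \<sigma>)\<^sup>T) $$ (i, j) = A $$ (\<sigma> i, \<sigma> j)"
proof -
  have s: "\<sigma> l < n" if "l < n" for l using assms that by auto
  have PA: "(perm_mat n \<sigma> * A) $$ (i, l) = A $$ (\<sigma> i, l)" if "l < n" for l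
    using A ij s that
    by (auto simp: perm_mat_def scalar_prod_def if_distrib if_distribR cong: if_cong)
  have "(perm_mat n \<sigma> * A * (perm_mat n \<sigma>)\<^sup>T) $$ (i, j) =
    (\<Sum>l = 0..<n. (perm_mat n \<sigma> * A) $$ (i, l) * perm_mat n \<sigma> $$ (j, l))"
    using A ij by (auto simp: perm_mat_def scalar_prod_def intro!: sum.cong)
  also have "\<dots> = (\<Sum>l = 0..<n. if l = \<sigma> j then A $$ (\<sigma> i, l) else 0)"
    by (rule sum.cong) (use PA ij in \<open>auto simp: perm_mat_def\<close>)
  also have "\<dots> = A $$ (\<sigma> i, \<sigma> j)" using s ij by simp
  finally show ?thesis .
qed

text \<open>This is conjugation of the identity matrix: reindexing turns the entry at
  \<open>(i, j)\<close> into the one at \<open>(\<sigma> i, \<sigma> j)\<close>, and injectivity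
  keeps diagonal and off-diagonal positions apart.\<close>

lemma perm_mat_mult_transpose:
  assumes "inj_on \<sigma> {..<n}" and "\<sigma> ` {..<n} \<subseteq> {..<n}"
  shows "perm_mat n \<sigma> * (perm_mat n \<sigma>)\<^sup>T = (1\<^sub>m n :: 'a :: semiring_1 mat)"
proof (rule eq_matI)
  fix i j assume "i < dim_row (1\<^sub>m n :: 'a mat)" "j < dim_col (1\<^sub>m n :: 'a mat)"
  hence ij: "i < n" "j < n" by auto
  hence "\<sigma> i < n" "\<sigma> i = \<sigma> j \<longleftrightarrow> i = j" using assms by (auto simp: inj_on_def)
  moreover have "(perm_mat n \<sigma> * (perm_mat n \<sigma>)\<^sup>T) $$ (i, j) = (1\<^sub>m n :: 'a mat) $$ (\<sigma> i, \<sigma> j)"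
    using perm_mat_conjugate_index[OF one_carrier_mat assms(2) ij, where 'a = 'a]
    by (simp add: right_mult_one_mat[OF perm_mat_carrier])
  moreover have "\<sigma> j < n" using ij assms(2) by auto
  ultimately show "(perm_mat n \<sigma> * (perm_mat n \<sigma>)\<^sup>T) $$ (i, j) = (1\<^sub>m n :: 'a mat) $$ (i, j)"
    using ij by simp
qed (auto simp: perm_mat_def)

lemma symplectic_J_carrier [simp, intro]: "symplectic_J m \<in> carrier_mat (2 * m) (2 * m)"
  by (simp add: symplectic_J_def mult_2)

lemma symplectic_J_index:
  assumes "i < 2 * m" "j < 2 * m"
  shows "symplectic_J m $$ (i, j) = (if j = i + m then 1 else if i = j + m then -1 else 0)"
  using assms by (auto simp: symplectic_J_def)

text \<open>Call the two halves of the first basis \<open>x\<close>, \<open>y\<close> (length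
  \<open>p\<close>) and of the second \<open>x'\<close>, \<open>y'\<close> (length
  \<open>q\<close>). A position in the order \<open>x, x', y, y'\<close> is sent to its position in
  the order \<open>x, y, x', y'\<close>.\<close>

definition interleave :: "nat \<Rightarrow> nat \<Rightarrow> nat \<Rightarrow> nat" where
  "interleave p q i =
    (if i < p then i else if i < p + q then i + p else if i < 2 * p + q then i - q else i)"

lemma inj_interleave: "inj (interleave p q)"
  by (rule injI) (simp add: interleave_def split: if_splits)

lemma interleave_image: "interleave p q ` {..<2 * (p + q)} \<subseteq> {..<2 * (p + q)}"
  by (auto simp: interleave_def)

text \<open>The permutation respects symplectic partners: the partner of \<open>i\<close> lies
  \<open>p + q\<close> further on, while in the direct sum the partner lies \<open>p\<close> further
  within the first block and \<open>q\<close> further within the second.\<close>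

lemma interleave_pairing:
  fixes p q i j :: nat
  defines "k \<equiv> interleave p q i" and "l \<equiv> interleave p q j"
  assumes "i < 2 * (p + q)" "j < 2 * (p + q)"
  shows "(k < 2 * p \<and> l < 2 * p \<and> l = k + p) \<or> (2 * p \<le> k \<and> 2 * p \<le> l \<and> l = k + q) \<longleftrightarrow>
    j = i + (p + q)"
proof -
  \<comment> \<open>Writing \<open>k + q = i\<close> avoids truncated subtraction, so every
    combination of cases is linear arithmetic.\<close>
  have "i < p \<and> k = i \<or> p \<le> i \<and> i < p + q \<and> k = i + p
    \<or> p + q \<le> i \<and> i < 2 * p + q \<and> k + q = i \<or> 2 * p + q \<le> i \<and> k = i"
    by (simp add: k_def interleave_def)
  moreover have "j < p \<and> l = j \<or> p \<le> j \<and> j < p + q \<and> l = j + p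
    \<or> p + q \<le> j \<and> j < 2 * p + q \<and> l + q = j \<or> 2 * p + q \<le> j \<and> l = j"
    by (simp add: l_def interleave_def)
  ultimately show ?thesis
    using assms(3,4) by (elim disjE conjE; auto)
qed
text \<open>The conditions for \<open>1\<close> and \<open>-1\<close> are phrased as the left side
  of \<open>interleave_pairing\<close>, the latter with the indices exchanged, so that both can be
  rewritten by it.\<close>

lemma symplectic_J_sum_index:
  assumes "k < 2 * (p + q)" "l < 2 * (p + q)"
  shows "four_block_mat (symplectic_J p) (0\<^sub>m (2 * p) (2 * q)) (0\<^sub>m (2 * q) (2 * p)) (symplectic_J q)
      $$ (k, l) =
    (if k < 2 * p \<and> l < 2 * p \<and> l = k + p \<or> 2 * p \<le> k \<and> 2 * p \<le> l \<and> l = k + q then 1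
     else if l < 2 * p \<and> k < 2 * p \<and> k = l + p \<or> 2 * p \<le> l \<and> 2 * p \<le> k \<and> k = l + q then -1
     else 0)"
proof -
  note dims = carrier_matD[OF symplectic_J_carrier]
  show ?thesis
  proof (cases "k < 2 * p \<or> l < 2 * p")
    case True
    thus ?thesis using assms
      by (cases "k < 2 * p"; cases "l < 2 * p") (simp_all add: dims symplectic_J_index)
  next
    case False
    \<comment> \<open>Both indices lie in the second block; the offsets remove the subtraction of
      \<open>2 * p\<close> made by block indexing.\<close>
    then obtain k' l' where "k = 2 * p + k'" "l = 2 * p + l'"
      by (metis le_iff_add not_less)
    thus ?thesis using assms by (simp add: dims symplectic_J_index)
  qed
qed

lemma symplectic_J_add:
  defines "P \<equiv> \<lambda>p q. perm_mat (2 * (p + q)) (interleave p q)"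
  shows "symplectic_J (p + q) = P p q *
    four_block_mat (symplectic_J p) (0\<^sub>m (2 * p) (2 * q)) (0\<^sub>m (2 * q) (2 * p)) (symplectic_J q) *
    (P p q)\<^sup>T" (is "_ = _ * ?J * _")
proof (rule eq_matI)
  have J: "?J \<in> carrier_mat (2 * (p + q)) (2 * (p + q))"
    unfolding distrib_left by (rule four_block_carrier_mat) auto
  fix i j
  assume "i < dim_row (P p q * ?J * (P p q)\<^sup>T)" "j < dim_col (P p q * ?J * (P p q)\<^sup>T)"
  hence ij: "i < 2 * (p + q)" "j < 2 * (p + q)" by (auto simp: P_def perm_mat_def)
  have s: "interleave p q i < 2 * (p + q)" "interleave p q j < 2 * (p + q)"
    using ij interleave_image[of p q] by auto
  have "(P p q * ?J * (P p q)\<^sup>T) $$ (i, j) = ?J $$ (interleave p q i, interleave p q j)"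
    unfolding P_def by (rule perm_mat_conjugate_index[OF J interleave_image ij])
  also have "\<dots> = symplectic_J (p + q) $$ (i, j)"
    unfolding symplectic_J_sum_index[OF s] symplectic_J_index[OF ij]
      interleave_pairing[OF ij] interleave_pairing[OF ij(2,1)] ..
  finally show "symplectic_J (p + q) $$ (i, j) = (P p q * ?J * (P p q)\<^sup>T) $$ (i, j)" ..
qed (auto simp: P_def perm_mat_def carrier_matD[OF symplectic_J_carrier])

text \<open>For orthogonal \<open>P\<close>, the map sending \<open>X\<close> to
  \<open>P * X * P\<^sup>T\<close> preserves sums, products and transposes, hence carries the whole
  equation along.\<close>

lemma hamiltonian_equation_conjugate:
  fixes P :: "'a :: comm_ring_1 mat"
  assumes c: "P \<in> carrier_mat n n" "D \<in> carrier_mat n n" "K \<in> carrier_mat n n"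
    and orth: "P\<^sup>T * P = 1\<^sub>m n" and DK: "D\<^sup>T * K + K * D = 0\<^sub>m n n"
  shows "(P * D * P\<^sup>T)\<^sup>T * (P * K * P\<^sup>T) + (P * K * P\<^sup>T) * (P * D * P\<^sup>T) = 0\<^sub>m n n"
proof -
  have mult: "(P * X * P\<^sup>T) * (P * Y * P\<^sup>T) = P * (X * Y) * P\<^sup>T"
    if X: "X \<in> carrier_mat n n" and Y: "Y \<in> carrier_mat n n" for X Y
  proof -
    have "(P * X * P\<^sup>T) * (P * Y * P\<^sup>T) = P * X * (P\<^sup>T * P) * Y * P\<^sup>T"
      using c X Y by (simp add: assoc_mult_mat[where ?n\<^sub>1.0 = n and ?n\<^sub>2.0 = n and ?n\<^sub>3.0 = n and ?n\<^sub>4.0 = n])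
    thus ?thesis using c X Y
      by (simp add: orth assoc_mult_mat[where ?n\<^sub>1.0 = n and ?n\<^sub>2.0 = n and ?n\<^sub>3.0 = n and ?n\<^sub>4.0 = n])
  qed
  have DT: "(P * D * P\<^sup>T)\<^sup>T = P * D\<^sup>T * P\<^sup>T"
    using c by (simp add: transpose_mult[where n = n and nr = n and nc = n]
      assoc_mult_mat[where ?n\<^sub>1.0 = n and ?n\<^sub>2.0 = n and ?n\<^sub>3.0 = n and ?n\<^sub>4.0 = n])
  have "(P * D * P\<^sup>T)\<^sup>T * (P * K * P\<^sup>T) + (P * K * P\<^sup>T) * (P * D * P\<^sup>T) =
    P * (D\<^sup>T * K) * P\<^sup>T + P * (K * D) * P\<^sup>T"
    using c by (subst DT, subst (1 2) mult) auto
  also have "\<dots> = P * (D\<^sup>T * K + K * D) * P\<^sup>T"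
    using c by (simp add: add_mult_distrib_mat[where nr = n and n = n and nc = n]
      mult_add_distrib_mat[where nr = n and n = n and nc = n])
  also have "\<dots> = 0\<^sub>m n n" using c by (simp add: DK)
  finally show ?thesis .
qed

text \<open>Transposition, product and sum of block diagonal matrices act blockwise, so the equation
  splits into the two given ones.\<close>

lemma diag_block_hamiltonian_equation:
  fixes A B :: "'a :: comm_ring_1 mat"
  assumes A: "A \<in> carrier_mat n n" "K \<in> carrier_mat n n" "A\<^sup>T * K + K * A = 0\<^sub>m n n"
    and B: "B \<in> carrier_mat k k" "L \<in> carrier_mat k k" "B\<^sup>T * L + L * B = 0\<^sub>m k k"
  defines "diag \<equiv> \<lambda>X Y :: 'a mat. four_block_mat X (0\<^sub>m n k) (0\<^sub>m k n) Y"
  shows "(diag A B)\<^sup>T * diag K L + diag K L * diag A B = 0\<^sub>m (n + k) (n + k)"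
proof -
  have mult: "diag X Y * diag X' Y' = diag (X * X') (Y * Y')"
    if "X \<in> carrier_mat n n" "Y \<in> carrier_mat k k" "X' \<in> carrier_mat n n" "Y' \<in> carrier_mat k k"
    for X Y X' Y'
    unfolding diag_def using that
    by (subst mult_four_block_mat[where ?nr1.0 = n and ?n1.0 = n and ?nc1.0 = n
        and ?nr2.0 = k and ?n2.0 = k and ?nc2.0 = k]) auto
  have tr: "(diag A B)\<^sup>T = diag A\<^sup>T B\<^sup>T"
    unfolding diag_def using A B by (subst transpose_four_block_mat) auto
  have "diag (A\<^sup>T * K) (B\<^sup>T * L) + diag (K * A) (L * B) =
      diag (A\<^sup>T * K + K * A) (B\<^sup>T * L + L * B)"
    unfolding diag_def using A B
    by (subst add_four_block_mat[where ?nr1.0 = n and ?nc1.0 = n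
        and ?nr2.0 = k and ?nc2.0 = k]) auto
  also have "\<dots> = 0\<^sub>m (n + k) (n + k)" by (simp add: A B diag_def)
  finally show ?thesis using A B by (simp add: tr mult)
qed

lemma hamiltonian_mat_direct_sum:
  assumes A: "hamiltonian_mat p A" and B: "hamiltonian_mat q B"
  obtains C where "hamiltonian_mat (p + q) C" and "char_poly C = char_poly A * char_poly B"
proof -
  let ?n = "2 * (p + q)"
  define D where "D = four_block_mat A (0\<^sub>m (2 * p) (2 * q)) (0\<^sub>m (2 * q) (2 * p)) B"
  define K where "K = four_block_mat (symplectic_J p) (0\<^sub>m (2 * p) (2 * q))
    (0\<^sub>m (2 * q) (2 * p)) (symplectic_J q)"
  define P :: "real mat" where "P = perm_mat ?n (interleave p q)"
  have Ac: "A \<in> carrier_mat (2 * p) (2 * p)" and Bc: "B \<in> carrier_mat (2 * q) (2 * q)"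
    and AJ: "A\<^sup>T * symplectic_J p + symplectic_J p * A = 0\<^sub>m (2 * p) (2 * p)"
    and BJ: "B\<^sup>T * symplectic_J q + symplectic_J q * B = 0\<^sub>m (2 * q) (2 * q)"
    using A B by (auto simp: hamiltonian_mat_def)
  have carr: "P \<in> carrier_mat ?n ?n" "D \<in> carrier_mat ?n ?n" "K \<in> carrier_mat ?n ?n"
    using four_block_carrier_mat[OF Ac Bc]
      four_block_carrier_mat[OF symplectic_J_carrier[of p] symplectic_J_carrier[of q]]
    by (simp_all add: P_def D_def K_def distrib_left[of 2])
  have PPt: "P * P\<^sup>T = 1\<^sub>m ?n"
    unfolding P_def by (rule perm_mat_mult_transpose[OF inj_on_subset[OF inj_interleave subset_UNIV] interleave_image])
  \<comment> \<open>A one-sided inverse of a square matrix over a field is two-sided; conjugating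
    the equation needs the product in this order.\<close>
  have PtP: "P\<^sup>T * P = 1\<^sub>m ?n"
    using mat_mult_left_right_inverse[OF _ _ PPt] carr by simp
  have "D\<^sup>T * K + K * D = 0\<^sub>m ?n ?n"
    using diag_block_hamiltonian_equation[OF Ac symplectic_J_carrier AJ Bc symplectic_J_carrier BJ]
    by (simp add: D_def K_def distrib_left)
  hence "(P * D * P\<^sup>T)\<^sup>T * (P * K * P\<^sup>T) + (P * K * P\<^sup>T) * (P * D * P\<^sup>T) = 0\<^sub>m ?n ?n"
    by (rule hamiltonian_equation_conjugate[OF carr PtP])
  moreover have "P * K * P\<^sup>T = symplectic_J (p + q)"
    unfolding P_def K_def by (rule symplectic_J_add[symmetric])
  ultimately have "hamiltonian_mat (p + q) (P * D * P\<^sup>T)"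
    unfolding hamiltonian_mat_def using carr by auto
  moreover have "similar_mat (P * D * P\<^sup>T) D"
    by (rule similar_matI[OF _ PPt PtP refl]) (use carr in auto)
  hence "char_poly (P * D * P\<^sup>T) = char_poly A * char_poly B"
    using char_poly_diag_block[OF Ac Bc] by (simp add: char_poly_similar D_def)
  ultimately show thesis by (rule that)
qed

text \<open>The factorization holds over the reals; embedding the coefficients into the complex
  numbers preserves it, and roots of a product add with multiplicity.\<close>

lemma spectrum_mset_mult:
  assumes c: "A \<in> carrier_mat n n" "B \<in> carrier_mat k k" "C \<in> carrier_mat l l"
    and C: "char_poly C = char_poly A * char_poly B"
  shows "spectrum_mset C = spectrum_mset A + spectrum_mset B"
proof -
  interpret map_poly_comm_ring_hom complex_of_real ..
  \<comment> \<open>\<open>proots_mult\<close> requires nonzero factors; monic polynomials are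
    nonzero.\<close>
  have nz: "char_poly X \<noteq> 0" if "X \<in> carrier_mat r r" for X :: "complex mat" and r
    using degree_monic_char_poly[OF that] by auto
  have "char_poly (map_mat complex_of_real C) =
    char_poly (map_mat complex_of_real A) * char_poly (map_mat complex_of_real B)"
    using c C by (simp add: of_real_hom.char_poly_hom hom_mult)
  thus ?thesis
    using c nz[of "map_mat complex_of_real A" n] nz[of "map_mat complex_of_real B" k]
    by (simp add: spectrum_mset_def proots_mult)
qed

lemma H_realizable_add:
  assumes "H_realizable \<Gamma>" and "H_realizable \<Delta>"
  shows "H_realizable (\<Gamma> + \<Delta>)"
proof -
  obtain p A where A: "p \<ge> 1" "hamiltonian_mat p A" "spectrum_mset A = \<Gamma>"
    using assms(1) by (auto simp: H_realizable_def)
  obtain q B where B: "hamiltonian_mat q B" "spectrum_mset B = \<Delta>"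
    using assms(2) by (auto simp: H_realizable_def)
  obtain C where C: "hamiltonian_mat (p + q) C" "char_poly C = char_poly A * char_poly B"
    using hamiltonian_mat_direct_sum[OF A(2) B(1)] by blast
  have "spectrum_mset C = \<Gamma> + \<Delta>"
    using spectrum_mset_mult[OF _ _ _ C(2)] A B C by (auto simp: hamiltonian_mat_def)
  thus ?thesis using A(1) C(1) by (auto simp: H_realizable_def intro!: exI[of _ "p + q"])
qed

theorem theorem8:
  fixes n :: nat and \<Gamma> :: "nat \<Rightarrow> complex multiset"
  assumes "n \<ge> 1"
    and "\<And>k. k \<in> {1..n} \<Longrightarrow> H_realizable (\<Gamma> k)"
  shows "H_realizable (\<Sum>k=1..n. \<Gamma> k)"
  using assms
proof (induction n rule: dec_induct)
  \<comment> \<open>The induction starts at one list: the empty sum is not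
    \<open>H_realizable\<close>, because \<open>m \<ge> 1\<close> forces a nonempty
    spectrum.\<close>
  case base
  thus ?case by simp
next
  case (step n)
  thus ?case by (auto intro!: H_realizable_add)
qed

end
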